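(* Let $k,t,p,q$ be positive integers with $k \geq 2t$, $1 \leq p \leq 2t-1$, and suppose $C_{p,q}$ is a submatrix of $A_{k,t}$. If $q \geq p-1$, then $q \leq k-2t+1$.
   Context: For positive integers $k,t$ with $k\ge t$, $A_{k,t}$ is the $0,1$-matrix of size $\binom{k}{t}\times\binom{k}{t}$ whose rows and columns are indexed by all $t$-element subsets of $[k]=\{1,\dots,k\}$, with entry $1$ in row $x$, column $y$ if and only if $x\cap y\neq\emptyset$. For integers $p\ge 1$, $q\ge 0$ and $n=p+q$, $C_{p,q}$ is the $n\times n$ circulant $0,1$-matrix whose entry in row $i$, column $j$ ($1\le i,j\le n$) is $1$ iff $(i-j) \bmod n \in\{0,1,\dots,p-1\}$ (so its first column is $p$ ones followed by $q$ zeros). An $n\times m$ $0,1$-matrix $M$ is a submatrix of $A_{k,t}$ if there are distinct $t$-subsets $F_1,\dots,F_n$ of $[k]$ and distinct $t$-subsets $G_1,\dots,G_m$ of $[k]$ with $M_{ij}=1$ iff $F_i\cap G_j\ne\emptyset$. *)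

theory Defs
  imports "Jordan_Normal_Form.Matrix"
begin

definition t_subsets :: "nat \<Rightarrow> nat \<Rightarrow> nat set set" where
  "t_subsets k t = {x. x \<subseteq> {1..k} \<and> card x = t}"

(* The matrix A_{k,t} is indexed by sets, hence given as a function of two indices;
   outside its index set t_subsets k t it takes the dummy value 0. *)
definition A_mat :: "nat \<Rightarrow> nat \<Rightarrow> nat set \<Rightarrow> nat set \<Rightarrow> nat" where
  "A_mat k t x y =
     (if x \<in> t_subsets k t \<and> y \<in> t_subsets k t \<and> x \<inter> y \<noteq> {} then 1 else 0)"

(* Rows and columns are numbered from 0 here, not from 1; the entries depend only on i - j.
   The subtraction is on int, where mod yields the representative in {0..<p+q}. *)
definition C_mat :: "nat \<Rightarrow> nat \<Rightarrow> nat mat" where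
  "C_mat p q = mat (p + q) (p + q)
     (\<lambda>(i, j). if (int i - int j) mod int (p + q) \<in> {0..int p - 1} then 1 else 0)"

(* Rows and columns may be selected in any order, so this is more general than a
   submatrix with respect to a fixed ordering of the index set. *)
definition submatrix_of_A :: "nat mat \<Rightarrow> nat \<Rightarrow> nat \<Rightarrow> bool" where
  "submatrix_of_A M k t \<longleftrightarrow>
     (\<exists>F G. inj_on F {..<dim_row M} \<and> F ` {..<dim_row M} \<subseteq> t_subsets k t \<and>
            inj_on G {..<dim_col M} \<and> G ` {..<dim_col M} \<subseteq> t_subsets k t \<and>
            (\<forall>i<dim_row M. \<forall>j<dim_col M. M $$ (i, j) = A_mat k t (F i) (G j)))"

end

(* Elements x m of F r \<inter> G (r - p + 1), for the q - 1 rows r = p + 1 + m with p < r < p + q,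
   lie outside the disjoint sets F 0 and G 1. They are distinct: for l < m, F (p + 1 + m) does not
   meet G (l + 2). So the ground set has at least 2t + (q - 1) elements. *)
theory Submission
  imports Defs
begin

text \<open>This replaces \<open>mod\<close> on \<open>int\<close> by differences of naturals. For j
  > i the residue of i - j is i - j + p + q, which is below p exactly when j - i exceeds q.\<close>

lemma C_mat_index:
  assumes "i < p + q" and "j < p + q"
  shows "C_mat p q $$ (i, j) = (if (if j \<le> i then i - j < p else q < j - i) then 1 else 0)"
proof (cases "j \<le> i")
  case True
  have "(int i - int j) mod int (p + q) = int i - int j"
    using True assms by (intro mod_pos_pos_trivial) auto
  then show ?thesis
    using True assms by (auto simp: C_mat_def)
next
  case False
  have "(int i - int j) mod int (p + q) = (int i - int j + int (p + q)) mod int (p + q)"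
    by simp
  also have "\<dots> = int i - int j + int (p + q)"
    using False assms by (intro mod_pos_pos_trivial) auto
  finally show ?thesis
    using False assms by (auto simp: C_mat_def)
qed

text \<open>The additive form of the bound avoids the truncated subtraction \<open>k - 2 * t\<close>
  and matches a count of elements in {1..k}.\<close>

lemma C_mat_submatrix_of_A_imp_le:
  assumes "p > 0" and "q > 0" and "submatrix_of_A (C_mat p q) k t"
  shows "2 * t + (q - 1) \<le> k"
proof -
  have dims: "dim_row (C_mat p q) = p + q" "dim_col (C_mat p q) = p + q"
    by (simp_all add: C_mat_def)
  obtain F G where "F ` {..<p + q} \<subseteq> t_subsets k t" "G ` {..<p + q} \<subseteq> t_subsets k t"
    and FG: "\<And>i j. i < p + q \<Longrightarrow> j < p + q \<Longrightarrow> C_mat p q $$ (i, j) = A_mat k t (F i) (G j)"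
    using assms(3) unfolding submatrix_of_A_def dims by auto
  then have F: "\<And>i. i < p + q \<Longrightarrow> F i \<in> t_subsets k t"
    and G: "\<And>j. j < p + q \<Longrightarrow> G j \<in> t_subsets k t"
    by auto
  \<comment> \<open>Column j has its ones in rows j, ..., j + p - 1, read cyclically; the
    \<open>else\<close> branch is the part that wraps around to the top rows.\<close>
  have meet: "F i \<inter> G j \<noteq> {} \<longleftrightarrow> (if j \<le> i then i - j < p else q < j - i)"
    if "i < p + q" "j < p + q" for i j
    using FG[OF that] F[OF that(1)] G[OF that(2)]
    by (auto simp: C_mat_index[OF that] A_mat_def split: if_splits)
  \<comment> \<open>Row minus column is p - 1, so this entry is the last 1 in the run of column m +
    2.\<close>
  have "F (p + 1 + m) \<inter> G (m + 2) \<noteq> {}" if "m < q - 1" for m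
    using meet[of "p + 1 + m" "m + 2"] \<open>p > 0\<close> that by simp
  then have "\<forall>m. \<exists>y. m < q - 1 \<longrightarrow> y \<in> F (p + 1 + m) \<inter> G (m + 2)"
    by blast
  then obtain x where x: "\<And>m. m < q - 1 \<Longrightarrow> x m \<in> F (p + 1 + m) \<inter> G (m + 2)"
    by metis
  have inj: "inj_on x {..<q - 1}"
  proof (rule linorder_inj_onI')
    fix l m assume lm: "l \<in> {..<q - 1}" "m \<in> {..<q - 1}" "l < m"
    \<comment> \<open>Here row minus column is p - 1 + (m - l) \<ge> p, so the row lies past the end
      of the run.\<close>
    then have "F (p + 1 + m) \<inter> G (l + 2) = {}"
      using meet[of "p + 1 + m" "l + 2"] \<open>p > 0\<close> by (auto simp: less_diff_conv)
    then show "x l \<noteq> x m"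
      using x[of l] x[of m] lm by auto
  qed
  \<comment> \<open>Since m + 2 \<le> q, the run of column m + 2 does not wrap to row 0. Row p + 1 +
    m exceeds column 1 by p + m \<ge> p.\<close>
  have "F 0 \<inter> G (m + 2) = {}" "F (p + 1 + m) \<inter> G 1 = {}" if "m < q - 1" for m
    using meet[of 0 "m + 2"] meet[of "p + 1 + m" 1] \<open>p > 0\<close> that by (auto simp: less_diff_conv)
  then have disj_x: "(F 0 \<union> G 1) \<inter> x ` {..<q - 1} = {}"
    using x by blast
  \<comment> \<open>The run of column 1 is rows 1, ..., p, which would reach row 0 only for q =
    0.\<close>
  have disj: "F 0 \<inter> G 1 = {}"
    using meet[of 0 1] assms(1,2) by auto
  have F0: "F 0 \<subseteq> {1..k}" "card (F 0) = t" and G1: "G 1 \<subseteq> {1..k}" "card (G 1) = t"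
    using F[of 0] G[of 1] assms(1,2) by (auto simp: t_subsets_def)
  have fin: "finite (F 0)" "finite (G 1)"
    using F0 G1 finite_subset by blast+
  have "x ` {..<q - 1} \<subseteq> {1..k}"
  proof (rule image_subsetI)
    fix m assume "m \<in> {..<q - 1}"
    then show "x m \<in> {1..k}"
      using x[of m] F[of "p + 1 + m"] by (auto simp: t_subsets_def less_diff_conv)
  qed
  then have "card (F 0 \<union> G 1 \<union> x ` {..<q - 1}) \<le> card {1..k}"
    using F0 G1 by (intro card_mono) auto
  moreover have "card (F 0 \<union> G 1 \<union> x ` {..<q - 1}) = 2 * t + (q - 1)"
    using fin disj disj_x F0 G1 card_image[OF inj] by (simp add: card_Un_disjoint)
  ultimately show ?thesis
    by simp
qed

theorem theorem2:
  fixes k t p q :: nat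
  assumes "k > 0" and "t > 0" and "p > 0" and "q > 0"
    and "k \<ge> 2 * t"
    and "1 \<le> p" and "p \<le> 2 * t - 1"
    and "submatrix_of_A (C_mat p q) k t"
    and "q \<ge> p - 1"
  shows "q \<le> k - 2 * t + 1"
  using C_mat_submatrix_of_A_imp_le[OF assms(3,4,8)] assms(4) by linarith

end
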